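(* For every integer $r\geq 4$, let $k=\lceil r/e\rceil$. Then \[\max\Big\{\prod_{i=1}^r x_i : (x_1,\ldots,x_r)\in\mathcal{X}_{r,k}\Big\}=\frac{r!}{r^r},\] and the unique tuple in $\mathcal{X}_{r,k}$ achieving the maximum is $x_i=i/r$ for every $i\in\{1,\ldots,r\}$.
   Context: For $1\leq k\leq\lfloor r/2\rfloor$, $\mathcal{X}_{r,k}$ is the set of $(x_1,\ldots,x_r)\in\mathbb{R}^r$ with $0<x_1\leq\cdots\leq x_r=1$ and $x_i+x_j\leq x_{i+j}$ for every $i\in\{1,\ldots,k\}$ and every integer $j$ with $i\leq j\leq r-i$. *)

theory Defs
  imports Complex_Main "HOL-Library.FuncSet"
begin

(* Tuples (x_1, ..., x_r) are 1-based: functions on {1..r}, fixed to the value "undefined"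
   outside {1..r}, so that equality of functions is equality of tuples.
   Writing i + j \<le> r for j \<le> r - i avoids truncated subtraction on nat.
   The set is meant for 1 \<le> k \<le> r div 2. *)
definition \<X> :: "nat \<Rightarrow> nat \<Rightarrow> (nat \<Rightarrow> real) set" where
  "\<X> r k = {x \<in> {1..r} \<rightarrow>\<^sub>E UNIV.
     0 < x 1 \<and> mono_on {1..r} x \<and> x r = 1 \<and>
     (\<forall>i\<in>{1..k}. \<forall>j. i \<le> j \<and> i + j \<le> r \<longrightarrow> x i + x j \<le> x (i + j))}"

end

theory Submission
  imports Defs
begin

text \<open>By the arithmetic-geometric mean inequality (with equality case) applied to the ratios
  $r x_i / i$ it suffices to show $\sum_{i \le r} x_i / i \le 1$. For a fully superadditive sequence
  $L$ the sums $S_n = \sum_{i \le n} L_i / i$ satisfy $S_n \le L_n$, equivalently $S_n / n$ is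
  nondecreasing. If $r \le 2k+1$ this applies to $x$ itself. Otherwise the reflected sequence with
  $L_q = x_q$ for $q \le k$ and $L_q = 1 - x_{r-q}$ for $q > k$ is superadditive up to index
  $2k+1$. As $x_m \le 1 - L_{r-m}$ for $m > k$, a Chebyshev-type inequality bounds
  $\sum_{i \le r} x_i / i$ by $h + (1 - h) r S_k / k$ with $h = \sum_{m=k+1}^r 1/m$. Finally
  $h \le \ln (r/k) \le 1$ and $r S_k / k \le L_k + L_{r-k} \le 1$.\<close>

section \<open>Superadditive sequences\<close>

text \<open>Strong induction: summing the bounds for smaller indices by Abel summation gives
  \<open>n * S (n - 1) <= 2 * (L 1 + ... + L (n - 1))\<close>, and pairing \<open>L m\<close> with
  \<open>L (n - m)\<close> bounds the right side by \<open>(n - 1) * L n\<close>.\<close>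

lemma superadditive_weighted_sum_le:
  fixes L :: "nat \<Rightarrow> real"
  assumes super: "\<And>i j. 1 \<le> i \<Longrightarrow> 1 \<le> j \<Longrightarrow> i + j \<le> N \<Longrightarrow> L i + L j \<le> L (i + j)"
    and "1 \<le> n" "n \<le> N"
  shows "(\<Sum>i=1..n. L i / real i) \<le> L n"
  using assms(2,3)
proof (induction n rule: less_induct)
  case (less n)
  define S where "S m = (\<Sum>i=1..m. L i / real i)" for m
  have ident: "(\<Sum>m=1..p. S m) = real (Suc p) * S p - (\<Sum>i=1..p. L i)" for p
  proof (induction p)
    case (Suc p)
    have "real (Suc p) * S (Suc p) = real (Suc p) * S p + L (Suc p)"
      by (simp add: S_def field_simps)
    with Suc show ?case by (simp add: algebra_simps)
  qed (simp add: S_def)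
  obtain p where p: "n = Suc p" using less.prems by (cases n) auto
  have "(\<Sum>m=1..p. S m) \<le> (\<Sum>m=1..p. L m)"
    by (intro sum_mono) (use less p in \<open>auto simp: S_def\<close>)
  then have *: "real n * S p \<le> 2 * (\<Sum>m=1..p. L m)"
    using ident[of p] p by simp
  have "(\<Sum>m=1..p. L m) = (\<Sum>m=1..p. L (n - m))"
    by (rule sum.reindex_bij_witness[of _ "\<lambda>m. n - m" "\<lambda>m. n - m"]) (auto simp: p)
  then have "2 * (\<Sum>m=1..p. L m) = (\<Sum>m=1..p. L m + L (n - m))"
    by (simp add: sum.distrib)
  also have "\<dots> \<le> (\<Sum>m=1..p. L n)"
  proof (intro sum_mono)
    fix m assume "m \<in> {1..p}"
    then show "L m + L (n - m) \<le> L n"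
      using super[of m "n - m"] less.prems p by auto
  qed
  finally have "real n * S p \<le> real p * L n" using * by simp
  then have "S p + L n / real n \<le> L n"
    by (simp add: p field_simps)
  then show ?case by (simp add: S_def p)
qed

text \<open>Because \<open>(n + 1) * S (n + 1) = (n + 1) * S n + L (n + 1)\<close>, a single step of
  the monotonicity of \<open>S n / n\<close> amounts to
  \<open>S (n + 1) <= L (n + 1)\<close>.\<close>

lemma superadditive_mean_mono:
  fixes L :: "nat \<Rightarrow> real"
  assumes super: "\<And>i j. 1 \<le> i \<Longrightarrow> 1 \<le> j \<Longrightarrow> i + j \<le> N \<Longrightarrow> L i + L j \<le> L (i + j)"
    and "1 \<le> m" "m \<le> n" "n \<le> N"
  shows "real n * (\<Sum>i=1..m. L i / real i) \<le> real m * (\<Sum>i=1..n. L i / real i)"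
  using assms(3,4)
proof (induction n rule: dec_induct)
  case (step n)
  define S where "S m = (\<Sum>i=1..m. L i / real i)" for m
  have "S (Suc n) \<le> L (Suc n)"
    unfolding S_def by (rule superadditive_weighted_sum_le[OF super]) (use step in auto)
  moreover have "real (Suc n) * S (Suc n) = real (Suc n) * S n + L (Suc n)"
    by (simp add: S_def field_simps)
  ultimately have "real (Suc n) * S n \<le> real n * S (Suc n)" by (simp add: algebra_simps)
  then have *: "real m * (real (Suc n) * S n) \<le> real m * (real n * S (Suc n))"
    by (rule mult_left_mono) simp
  have IH: "real n * S m \<le> real m * S n"
    unfolding S_def by (rule step.IH) (use step.prems in simp)
  have "real n * (real (Suc n) * S m) = real (Suc n) * (real n * S m)"
    by (rule mult.left_commute)
  also have "\<dots> \<le> real (Suc n) * (real m * S n)"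
    by (rule mult_left_mono[OF IH]) simp
  also have "\<dots> = real m * (real (Suc n) * S n)"
    by (rule mult.left_commute)
  also note *
  also have "real m * (real n * S (Suc n)) = real n * (real m * S (Suc n))"
    by (rule mult.left_commute)
  finally have "real n * (real (Suc n) * S m) \<le> real n * (real m * S (Suc n))" .
  then show ?case using step assms(2) by (simp add: S_def)
qed simp

section \<open>Chebyshev, harmonic-sum and AM-GM inequalities\<close>

text \<open>Hypothesis \<open>mean\<close> says that each new \<open>y\<close> is at least the
  average of its predecessors, which is what the induction step uses. This form suits
  \<open>L q / q\<close>: superadditivity makes its running means monotone, but not necessarily its
  terms.\<close>

lemma Chebyshev_sum_mean_mono:
  fixes b y :: "nat \<Rightarrow> real"
  assumes b: "\<And>i j. 1 \<le> i \<Longrightarrow> i \<le> j \<Longrightarrow> j \<le> n \<Longrightarrow> b i \<le> b j"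
    and mean: "\<And>m. 1 \<le> m \<Longrightarrow> m < n \<Longrightarrow>
      real (Suc m) * (\<Sum>i=1..m. y i) \<le> real m * (\<Sum>i=1..Suc m. y i)"
  shows "(\<Sum>i=1..n. b i) * (\<Sum>i=1..n. y i) \<le> real n * (\<Sum>i=1..n. b i * y i)"
  using assms
proof (induction n)
  case (Suc n)
  show ?case
  proof (cases "n = 0")
    case False
    define B Y P where "B = (\<Sum>i=1..n. b i)" and "Y = (\<Sum>i=1..n. y i)"
      and "P = (\<Sum>i=1..n. b i * y i)"
    have IH: "B * Y \<le> real n * P"
      unfolding B_def Y_def P_def by (rule Suc.IH) (use Suc.prems in auto)
    have "B \<le> (\<Sum>i=1..n. b (Suc n))"
      unfolding B_def by (intro sum_mono) (use Suc.prems(1) in auto)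
    then have B: "0 \<le> real n * b (Suc n) - B" by simp
    have Y: "0 \<le> real n * y (Suc n) - Y"
      using Suc.prems(2)[of n] False by (simp add: Y_def algebra_simps)
    \<comment> \<open>The Chebyshev defect for \<open>n + 1\<close>, times \<open>n\<close>, is a
      product of two nonnegative factors plus \<open>n + 1\<close> times the defect for
      \<open>n\<close>.\<close>
    have "0 \<le> (real n * b (Suc n) - B) * (real n * y (Suc n) - Y)
              + real (Suc n) * (real n * P - B * Y)"
      using IH B Y by (intro add_nonneg_nonneg mult_nonneg_nonneg) auto
    also have "\<dots> = real n * (real (Suc n) * (P + b (Suc n) * y (Suc n))
                - (B + b (Suc n)) * (Y + y (Suc n)))"
      by (simp add: algebra_simps)
    finally have "0 \<le> real (Suc n) * (P + b (Suc n) * y (Suc n)) - (B + b (Suc n)) * (Y + y (Suc n))"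
      using False by (simp add: zero_le_mult_iff)
    then show ?thesis by (simp add: B_def Y_def P_def)
  qed simp
qed simp

lemma sum_inverse_le_ln:
  assumes "1 \<le> k" "k \<le> r"
  shows "(\<Sum>m=Suc k..r. 1 / real m) \<le> ln (real r / real k)"
  using assms(2)
proof (induction r rule: dec_induct)
  case (step n)
  have n: "0 < n" using step assms by simp
  \<comment> \<open>This yields \<open>1 / (n + 1) <= ln ((n + 1) / n)\<close>, which
    telescopes.\<close>
  have "ln (real n / real (Suc n)) \<le> real n / real (Suc n) - 1"
    by (rule ln_le_minus_one) (use n in simp)
  also have "\<dots> = - 1 / real (Suc n)" by (simp add: field_simps)
  finally show ?case using step n assms(1) by (simp add: ln_div)
qed (use assms in simp)

text \<open>Each gap \<open>z i - 1 - ln (z i)\<close> is nonnegative and vanishes only at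
  \<open>z i = 1\<close>, while the gaps add up to at most \<open>- ln (prod z A)\<close>.\<close>

lemma prod_le_one_of_sum_le:
  fixes z :: "'a \<Rightarrow> real"
  assumes fin: "finite A" and pos: "\<And>i. i \<in> A \<Longrightarrow> 0 < z i"
    and sum: "(\<Sum>i\<in>A. z i) \<le> real (card A)"
  shows "prod z A \<le> 1" and "prod z A = 1 \<Longrightarrow> i \<in> A \<Longrightarrow> z i = 1"
proof -
  have gap: "0 \<le> z i - 1 - ln (z i)" if "i \<in> A" for i
    using ln_le_minus_one[OF pos[OF that]] by simp
  have ln: "ln (prod z A) = (\<Sum>i\<in>A. ln (z i))"
    by (rule ln_prod[OF fin]) (use pos in force)
  have total: "(\<Sum>i\<in>A. z i - 1 - ln (z i)) \<le> - ln (prod z A)"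
    using sum by (simp add: ln sum_subtractf)
  have gap_sum: "0 \<le> (\<Sum>i\<in>A. z i - 1 - ln (z i))" by (rule sum_nonneg) (rule gap)
  have "0 \<le> - ln (prod z A)"
    using gap_sum total by (rule order_trans)
  then show "prod z A \<le> 1"
    using prod_pos[of A z] pos by simp
  assume "prod z A = 1" and i: "i \<in> A"
  then have "(\<Sum>i\<in>A. z i - 1 - ln (z i)) = 0"
    using total gap_sum by simp
  then have "z i - 1 - ln (z i) = 0"
    using sum_nonneg_eq_0_iff[of A "\<lambda>i. z i - 1 - ln (z i)"] fin gap i by auto
  then show "z i = 1" using ln_eq_minus_one[of "z i"] pos[OF i] by simp
qed

section \<open>The weighted sum of a partially superadditive tuple\<close>

text \<open>The bound \<open>r <= 3 * k + 1\<close> puts \<open>r - k\<close> within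
  \<open>2 * k + 1\<close>, the range where the reflected sequence is superadditive;
  \<open>tail\<close> makes the final weight \<open>1 - h\<close> nonnegative.\<close>

lemma weighted_sum_le_one:
  fixes x :: "nat \<Rightarrow> real"
  assumes k: "1 \<le> k" "k < r" "r \<le> 3 * k + 1"
    and tail: "(\<Sum>m=Suc k..r. 1 / real m) \<le> 1"
    and super: "\<And>i j. 1 \<le> i \<Longrightarrow> i \<le> k \<Longrightarrow> i \<le> j \<Longrightarrow> i + j \<le> r \<Longrightarrow> x i + x j \<le> x (i + j)"
    and xr: "x r = 1"
  shows "(\<Sum>i=1..r. x i / real i) \<le> 1"
proof -
  have super': "x i + x j \<le> x (i + j)"
    if "1 \<le> i" "1 \<le> j" "i \<le> k \<or> j \<le> k" "i + j \<le> r" for i j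
    using super[of i j] super[of j i] that by (cases "i \<le> j") (auto simp: add.commute)
  show ?thesis
  proof (cases "r \<le> 2 * k + 1")
    case True
    have "(\<Sum>i=1..r. x i / real i) \<le> x r"
    proof (rule superadditive_weighted_sum_le[where N = r])
      fix i j :: nat assume "1 \<le> i" "1 \<le> j" "i + j \<le> r"
      \<comment> \<open>Two indices above \<open>k\<close> would already sum to at least
        \<open>2 * k + 2\<close>.\<close>
      moreover from this have "i \<le> k \<or> j \<le> k" using True by linarith
      ultimately show "x i + x j \<le> x (i + j)" using super' by blast
    qed (use k in auto)
    then show ?thesis using xr by simp
  next
    case False
    define L where "L q = (if q \<le> k then x q else 1 - x (r - q))" for q
    define S where "S n = (\<Sum>i=1..n. L i / real i)" for n
    define h where "h = (\<Sum>m=Suc k..r. 1 / real m)"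
    \<comment> \<open>Reflection \<open>q = r - m\<close> maps \<open>k + 1, ..., r - 1\<close> onto
      \<open>1, ..., n\<close>; the index \<open>r\<close> itself, with \<open>x r = 1\<close>, is
      split off.\<close>
    define n where "n = r - k - 1"
    have rn: "r = Suc (k + n)" "k < n" using False k by (auto simp: n_def)
    have L: "L i + L j \<le> L (i + j)" if "1 \<le> i" "1 \<le> j" "i + j \<le> 2 * k + 1" for i j
    proof -
      \<comment> \<open>After reflection this reads \<open>x (r - i - j) + x j <= x (r - i)\<close>,
        and \<open>j <= k\<close> since \<open>i > k\<close>.\<close>
      have refl: "L i + L j \<le> L (i + j)" if "k < i" "1 \<le> j" "i + j \<le> 2 * k + 1" for i j
      proof -
        have "1 \<le> r - (i + j)" "r - (i + j) + j = r - i" "j \<le> k" using that False by auto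
        then show ?thesis using super'[of "r - (i + j)" j] that by (auto simp: L_def)
      qed
      consider "k < i" | "k < j" | "i \<le> k" "j \<le> k" "i + j \<le> k" | "i \<le> k" "j \<le> k" "k < i + j"
        by linarith
      then show ?thesis
      proof cases
        case 1
        then show ?thesis using refl that by blast
      next
        case 2
        then show ?thesis using refl[of j i] that by (simp add: add.commute)
      next
        case 3
        then show ?thesis using super'[of i j] that k by (auto simp: L_def)
      next
        case 4
        \<comment> \<open>Here \<open>x i + x j + x (r - i - j) <= 1\<close> is needed: add
          \<open>i\<close> to reach \<open>r - j\<close>, then \<open>j\<close> to reach
          \<open>r\<close>.\<close>
        have "r - (i + j) + i = r - j" "1 \<le> r - (i + j)" "1 \<le> r - j" using that False by auto
        then show ?thesis
          using super'[of "r - (i + j)" i] super'[of "r - j" j] 4 that False xr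
          by (auto simp: L_def)
      qed
    qed
    have S_le: "S m \<le> L m" if "1 \<le> m" "m \<le> 2 * k + 1" for m
      unfolding S_def by (rule superadditive_weighted_sum_le[OF L]) (use that in auto)
    have S_mono: "real m' * S m \<le> real m * S m'" if "1 \<le> m" "m \<le> m'" "m' \<le> 2 * k + 1" for m m'
      unfolding S_def by (rule superadditive_mean_mono[OF L]) (use that in auto)
    \<comment> \<open>An equality by definition of \<open>L\<close> when \<open>r - m > k\<close>;
      otherwise superadditivity with \<open>x r = 1\<close>.\<close>
    have x_le: "x m \<le> 1 - L (r - m)" if "m \<in> {Suc k..k + n}" for m
    proof -
      have "1 \<le> r - m" "r - m + m = r" "1 \<le> m" "r - (r - m) = m" using that rn by auto
      then show ?thesis using super'[of "r - m" m] xr by (auto simp: L_def)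
    qed
    have refl_sum: "(\<Sum>m=Suc k..k + n. f (r - m) m) = (\<Sum>q=1..n. f q (r - q))"
      for f :: "nat \<Rightarrow> nat \<Rightarrow> real"
      by (rule sum.reindex_bij_witness[of _ "\<lambda>q. r - q" "\<lambda>q. r - q"]) (use rn in auto)
    \<comment> \<open>The term \<open>m = r\<close> vanishes, so the sum may run up to
      \<open>r\<close>, and \<open>(r - m) / m = r / m - 1\<close>.\<close>
    have mass: "(\<Sum>q=1..n. real q / real (r - q)) = real r * h - real (r - k)"
    proof -
      have "(\<Sum>q=1..n. real q / real (r - q)) = (\<Sum>m=Suc k..k + n. real (r - m) / real m)"
        by (rule refl_sum[symmetric])
      also have "\<dots> = (\<Sum>m=Suc k..r. real (r - m) / real m)" by (simp add: rn)
      also have "\<dots> = (\<Sum>m=Suc k..r. real r * (1 / real m) - 1)"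
        by (intro sum.cong) (auto simp: field_simps of_nat_diff)
      also have "\<dots> = real r * h - real (r - k)"
        by (simp add: sum_subtractf h_def sum_distrib_left)
      finally show ?thesis .
    qed
    have h_bounds: "0 \<le> 1 - h" using tail by (simp add: h_def)
    \<comment> \<open>The summand \<open>L q / (r - q)\<close> is split into the increasing weight
      \<open>q / (r - q)\<close> and \<open>L q / q\<close>, whose running means increase.\<close>
    have cheb: "(\<Sum>q=1..n. real q / real (r - q)) * S n
        \<le> real n * (\<Sum>q=1..n. (real q / real (r - q)) * (L q / real q))"
      unfolding S_def
    proof (rule Chebyshev_sum_mean_mono)
      fix i j :: nat assume "1 \<le> i" "i \<le> j" "j \<le> n"
      then show "real i / real (r - i) \<le> real j / real (r - j)"
        by (intro frac_le) (auto simp: rn)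
    next
      fix m assume "1 \<le> m" "m < n"
      then show "real (Suc m) * (\<Sum>i=1..m. L i / real i) \<le> real m * (\<Sum>i=1..Suc m. L i / real i)"
        using S_mono[of m "Suc m"] k rn unfolding S_def by simp
    qed
    define M where "M = S k / real k"
    have Sk: "S k = real k * M" using k by (simp add: M_def)
    have mean_le: "real q * M \<le> S q" if "k \<le> q" "q \<le> 2 * k + 1" for q
      using S_mono[of k q] k that by (simp add: M_def field_simps)
    have "0 \<le> (\<Sum>q=1..n. real q / real (r - q))" by (intro sum_nonneg) simp
    then have "(\<Sum>q=1..n. real q / real (r - q)) * (real n * M)
        \<le> (\<Sum>q=1..n. real q / real (r - q)) * S n"
      using mean_le[of n] rn k by (intro mult_left_mono) auto
    also note cheb
    also have "(\<Sum>q=1..n. (real q / real (r - q)) * (L q / real q)) = (\<Sum>q=1..n. L q / real (r - q))"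
      by (intro sum.cong) auto
    finally have "real n * ((real r * h - real (r - k)) * M)
        \<le> real n * (\<Sum>q=1..n. L q / real (r - q))"
      unfolding mass[symmetric] by (simp add: mult_ac)
    then have loss: "(real r * h - real (r - k)) * M \<le> (\<Sum>q=1..n. L q / real (r - q))"
      using rn by simp
    have "(\<Sum>i=1..r. x i / real i) = (\<Sum>i=1..k. x i / real i) + (\<Sum>i=Suc k..r. x i / real i)"
      using sum.ub_add_nat[of 1 k "\<lambda>i. x i / real i" "r - k"] k by simp
    also have "(\<Sum>i=1..k. x i / real i) = S k"
      unfolding S_def by (intro sum.cong) (auto simp: L_def)
    also have "(\<Sum>i=Suc k..r. x i / real i) = (\<Sum>i=Suc k..k + n. x i / real i) + 1 / real r"
      using xr by (simp add: rn)
    also have "(\<Sum>i=Suc k..k + n. x i / real i) \<le> (\<Sum>i=Suc k..k + n. (1 - L (r - i)) / real i)"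
      by (intro sum_mono divide_right_mono x_le) auto
    also have "\<dots> = (\<Sum>i=Suc k..k + n. 1 / real i) - (\<Sum>q=1..n. L q / real (r - q))"
      using refl_sum[of "\<lambda>q m. L q / real m"] by (simp add: diff_divide_distrib sum_subtractf)
    finally have "(\<Sum>i=1..r. x i / real i) \<le> S k + h - (\<Sum>q=1..n. L q / real (r - q))"
      by (simp add: h_def rn)
    also have "\<dots> \<le> S k + h - (real r * h - real (r - k)) * M"
      using loss by simp
    also have "\<dots> = h + (1 - h) * (real r * M)"
      using k by (simp add: Sk algebra_simps of_nat_diff)
    \<comment> \<open>Split \<open>r * M = k * M + (r - k) * M\<close>; the parts are at most
      \<open>L k = x k\<close> and \<open>L (r - k) = 1 - x k\<close>.\<close>
    also have "\<dots> \<le> h + (1 - h) * 1"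
    proof -
      have "k \<le> r - k" "r - k \<le> 2 * k + 1" "1 \<le> r - k" using k False by auto
      then have "real (r - k) * M \<le> L (r - k)"
        using mean_le S_le by (meson order_trans)
      moreover have "real k * M \<le> L k" using S_le[of k] k Sk by auto
      moreover have "L k + L (r - k) = 1" using k False by (auto simp: L_def)
      ultimately have "real r * M \<le> 1" using k by (simp add: of_nat_diff algebra_simps)
      then show ?thesis using h_bounds by (intro add_left_mono mult_left_mono)
    qed
    finally show ?thesis by simp
  qed
qed

section \<open>The choice of \<open>k\<close>, the product bound and uniqueness\<close>

text \<open>Rounding up gives \<open>r / k <= e\<close>, hence \<open>ln (r / k) <= 1\<close> for
  the harmonic tail, and \<open>r <= 3 * k\<close> from \<open>e <= 3\<close>.\<close>

lemma ceiling_div_exp_bounds: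
  assumes "r \<ge> 4" and k: "k = nat \<lceil>real r / exp 1\<rceil>"
  shows "1 \<le> k" "k < r" "r \<le> 3 * k" "(\<Sum>m=Suc k..r. 1 / real m) \<le> 1"
proof -
  have e: "2 \<le> exp (1::real)" "exp (1::real) \<le> 3"
    using exp_ge_add_one_self[of 1] exp_le by auto
  have pos: "0 < real r / exp 1" using assms by simp
  then show k1: "1 \<le> k" unfolding k by linarith
  have "real r / exp 1 \<le> real r / 2" using e by (intro divide_left_mono) auto
  moreover have "real k < real r / exp 1 + 1" using pos unfolding k by linarith
  ultimately show kr: "k < r" using assms(1) by linarith
  have "real r / exp 1 \<le> real k" unfolding k by linarith
  then have r: "real r \<le> real k * exp 1" by (simp add: field_simps)
  also have "\<dots> \<le> real k * 3" using e by (intro mult_left_mono) auto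
  finally show "r \<le> 3 * k" by linarith
  have "(\<Sum>m=Suc k..r. 1 / real m) \<le> ln (real r / real k)"
    using k1 kr by (intro sum_inverse_le_ln) auto
  also have "\<dots> \<le> ln (exp 1)"
    using k1 kr r by (subst ln_le_cancel_iff) (auto simp: field_simps)
  finally show "(\<Sum>m=Suc k..r. 1 / real m) \<le> 1" by simp
qed

lemma \<X>_prod_bound:
  assumes "r \<ge> 4" and "k = nat \<lceil>real r / exp 1\<rceil>" and x: "x \<in> \<X> r k"
  shows "(\<Prod>i=1..r. x i) \<le> fact r / real r ^ r"
    and "(\<Prod>i=1..r. x i) = fact r / real r ^ r \<Longrightarrow> x = (\<lambda>i\<in>{1..r}. real i / real r)"
proof -
  \<comment> \<open>Normalized so that the claimed maximizer becomes the constant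
    \<open>1\<close>.\<close>
  define z where "z i = real r * x i / real i" for i
  note k = ceiling_div_exp_bounds[OF assms(1,2)]
  have "(\<Sum>i=1..r. x i / real i) \<le> 1"
    by (rule weighted_sum_le_one[of k]) (use k x in \<open>auto simp: \<X>_def\<close>)
  then have "real r * (\<Sum>i=1..r. x i / real i) \<le> real r * 1"
    by (rule mult_left_mono) simp
  then have sum: "(\<Sum>i=1..r. z i) \<le> real (card {1..r})"
    by (simp add: z_def sum_distrib_left)
  have pos: "0 < z i" if "i \<in> {1..r}" for i
  proof -
    have "x 1 \<le> x i" using x that by (auto simp: \<X>_def intro!: mono_onD[where f = x])
    moreover have "0 < x 1" using x by (simp add: \<X>_def)
    ultimately show ?thesis using that by (simp add: z_def)
  qed
  have "(\<Prod>i=1..r. x i) = (\<Prod>i=1..r. real i / real r * z i)"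
    by (intro prod.cong) (auto simp: z_def)
  also have "\<dots> = fact r / real r ^ r * (\<Prod>i=1..r. z i)"
    by (simp add: prod.distrib prod_dividef fact_prod)
  finally have eq: "(\<Prod>i=1..r. x i) = fact r / real r ^ r * (\<Prod>i=1..r. z i)" .
  have c: "0 < fact r / real r ^ r" using assms(1) by simp
  show "(\<Prod>i=1..r. x i) \<le> fact r / real r ^ r"
    unfolding eq using prod_le_one_of_sum_le(1)[OF _ pos sum] c
    by (intro mult_left_le) auto
  assume "(\<Prod>i=1..r. x i) = fact r / real r ^ r"
  with eq have "fact r / real r ^ r * (\<Prod>i=1..r. z i) = fact r / real r ^ r * 1" by linarith
  then have "(\<Prod>i=1..r. z i) = 1"
    by (rule mult_left_cancel[THEN iffD1, OF c[THEN less_imp_neq, THEN not_sym]])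
  then have z: "z i = 1" if "i \<in> {1..r}" for i
    using prod_le_one_of_sum_le(2)[OF _ pos sum] that by blast
  have xi: "x i = real i / real r" if "i \<in> {1..r}" for i
    using z[OF that] that by (simp add: z_def field_simps)
  show "x = (\<lambda>i\<in>{1..r}. real i / real r)"
    \<comment> \<open>Outside \<open>{1..r}\<close> both functions are
      \<open>undefined\<close>.\<close>
    by (rule extensionalityI[of _ "{1..r}"]) (use x xi in \<open>auto simp: \<X>_def PiE_def\<close>)
qed

lemma linear_mem_\<X>:
  assumes "r \<ge> 1"
  shows "(\<lambda>i\<in>{1..r}. real i / real r) \<in> \<X> r k"
  using assms
  by (auto simp: \<X>_def add_divide_distrib intro!: mono_onI divide_right_mono)

theorem theorem3p1:
  fixes r k :: nat
  assumes "r \<ge> 4" and "k = nat \<lceil>real r / exp 1\<rceil>"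
  shows "fact r / real r ^ r \<in> (\<lambda>x. \<Prod>i=1..r. x i) ` \<X> r k
       \<and> (\<forall>p \<in> (\<lambda>x. \<Prod>i=1..r. x i) ` \<X> r k. p \<le> fact r / real r ^ r)
       \<and> {x. is_arg_max (\<lambda>x. \<Prod>i=1..r. x i) (\<lambda>x. x \<in> \<X> r k) x}
           = {\<lambda>i\<in>{1..r}. real i / real r}"
proof -
  define x0 where "x0 = (\<lambda>i\<in>{1..r}. real i / real r)"
  have x0: "x0 \<in> \<X> r k" unfolding x0_def using assms by (intro linear_mem_\<X>) simp
  have prod0: "(\<Prod>i=1..r. x0 i) = fact r / real r ^ r"
    by (simp add: x0_def prod_dividef fact_prod)
  note bound = \<X>_prod_bound[OF assms]
  have "is_arg_max (\<lambda>x. \<Prod>i=1..r. x i) (\<lambda>x. x \<in> \<X> r k) x \<longleftrightarrow> x = x0" for x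
  proof
    assume "is_arg_max (\<lambda>x. \<Prod>i=1..r. x i) (\<lambda>x. x \<in> \<X> r k) x"
    \<comment> \<open>Comparison with \<open>x0\<close> forces the product of a maximizer up to the
      bound, so the equality case applies.\<close>
    then have x: "x \<in> \<X> r k" and "(\<Prod>i=1..r. x0 i) \<le> (\<Prod>i=1..r. x i)"
      using x0 by (auto simp: is_arg_max_linorder)
    then show "x = x0"
      using bound[OF x] prod0 unfolding x0_def by simp
  next
    assume "x = x0"
    then show "is_arg_max (\<lambda>x. \<Prod>i=1..r. x i) (\<lambda>x. x \<in> \<X> r k) x"
      using x0 bound(1) prod0 by (auto simp: is_arg_max_linorder)
  qed
  then have "{x. is_arg_max (\<lambda>x. \<Prod>i=1..r. x i) (\<lambda>x. x \<in> \<X> r k) x} = {x0}" by blast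
  moreover have "fact r / real r ^ r \<in> (\<lambda>x. \<Prod>i=1..r. x i) ` \<X> r k"
    using x0 prod0 by (metis (no_types, lifting) image_eqI)
  ultimately show ?thesis using bound(1) by (auto simp: x0_def)
qed

end
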